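(* Let $H_1,H_2,H_4,H_5$ be Hilbert spaces over the same field ($\mathbb{R}$ or $\mathbb{C}$), let $A_1\in\mathcal{L}_c(H_1,H_4)$, $A_2\in\mathcal{L}_c(H_1,H_5)$, $B_1\in\mathcal{L}_c(H_2,H_4)$, $B_2\in\mathcal{L}_c(H_2,H_5)$, and let $A=(A_1,A_2):H_1\to H_4\times H_5$, $B=(B_1,B_2):H_2\to H_4\times H_5$. Consider the properties: (i) There exists $C>0$ such that for any $h_4\in H_4$, $\|A_1^*h_4\|_1\leqslant C\|B_1^*h_4\|_2$; and $\mathcal{N}(B^* )\subset\mathcal{N}(A^* )$, i.e. for all $(h_4,h_5)\in H_4\times H_5$, $B_1^*h_4+B_2^*h_5=0$ implies $A_1^*h_4+A_2^*h_5=0$. (ii) $A_1=B_1C_1$ for some $C_1\in\mathcal{L}_c(H_1,H_2)$ (or, equivalently, $A_1^*=D_1B_1^*$ for some $D_1\in\mathcal{L}_c(H_2,H_1)$); and $A^*=DB^*$ for some $D\in\mathcal{L}(H_2,H_1)$ not necessarily continuous. Then (i) and (ii) are equivalent, and they are necessary for the following property to hold: for any $h_1\in H_1$ and any $\varepsilon>0$, there exists $h_2\in H_2$ such that $A_1h_1=B_1h_2$ and $\|A_2h_1-B_2h_2\|_5\leqslant\varepsilon$.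
   Context: $\mathcal{L}_c(E,F)$ denotes the set of continuous linear maps from $E$ to $F$; $\mathcal{L}(E,F)$ denotes the set of all linear maps from $E$ to $F$, not necessarily continuous. $\mathcal{N}(T)$ is the kernel of $T$, $T^*$ is the Hilbert space adjoint of $T$, and $\|\cdot\|_i$ is the norm of $H_i$. The product $H_3=H_4\times H_5$ carries the Hilbertian norm $\|(h_4,h_5)\|_{H_3}^2=\|h_4\|_4^2+\|h_5\|_5^2$, so that $A^*(h_4,h_5)=A_1^*h_4+A_2^*h_5$ and $B^*(h_4,h_5)=B_1^*h_4+B_2^*h_5$. *)

theory Defs
  imports "HOL-Analysis.Analysis"
begin

(* The scalar field is the real or the complex numbers: complex_of is an isometric
   field embedding into the complex numbers that respects the reals, with image either
   the reals or everything. It is only used to speak of conjugation uniformly. *)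

class real_or_complex = real_normed_field +
  fixes complex_of :: "'a \<Rightarrow> complex"
  assumes complex_of_add: "complex_of (x + y) = complex_of x + complex_of y"
    and complex_of_mult: "complex_of (x * y) = complex_of x * complex_of y"
    and complex_of_scaleR: "complex_of (r *\<^sub>R x) = r *\<^sub>R complex_of x"
    and norm_complex_of: "norm (complex_of x) = norm x"
    and range_complex_of: "range complex_of = \<real> \<or> range complex_of = UNIV"

instantiation real :: real_or_complex
begin
definition complex_of_real_def: "complex_of (x::real) = complex_of_real x"
instance
  by standard (auto simp: complex_of_real_def Reals_def scaleR_conv_of_real)
end

instantiation complex :: real_or_complex
begin
definition complex_of_complex_def: "complex_of (x::complex) = x"
instance
  by standard (auto simp: complex_of_complex_def)
end

definition conjugate :: "'k::real_or_complex \<Rightarrow> 'k" where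
  "conjugate x = (THE y. complex_of y = cnj (complex_of x))"

lemma complex_of_inject: "complex_of x = complex_of y \<longleftrightarrow> x = y"
proof
  assume *: "complex_of x = complex_of y"
  have "complex_of (x - y) = complex_of x + complex_of ((-1) *\<^sub>R y)"
    by (simp flip: complex_of_add)
  also have "\<dots> = 0"
    unfolding complex_of_scaleR using * by simp
  finally have "norm (x - y) = 0"
    using norm_complex_of[of "x - y"] by simp
  then show "x = y" by simp
qed simp

lemma complex_of_conjugate:
  fixes x :: "'k::real_or_complex"
  shows "complex_of (conjugate x) = cnj (complex_of x)"
proof -
  have "cnj (complex_of x) \<in> range (complex_of :: 'k \<Rightarrow> complex)"
    using range_complex_of[where 'a = 'k]
  proof
    assume "range (complex_of :: 'k \<Rightarrow> complex) = \<real>"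
    then have "complex_of x \<in> \<real>" by blast
    then have "cnj (complex_of x) = complex_of x" by (simp add: Reals_cnj_iff)
    then show ?thesis by (metis rangeI)
  qed simp
  then obtain y :: 'k where "complex_of y = cnj (complex_of x)" by auto
  then show ?thesis
    unfolding conjugate_def by (rule theI) (metis \<open>complex_of y = _\<close> complex_of_inject)
qed

lemma conjugate_real: "conjugate (x::real) = x"
  using complex_of_conjugate[of x] by (simp add: complex_of_real_def)

lemma conjugate_complex: "conjugate (x::complex) = cnj x"
  using complex_of_conjugate[of x] by (simp add: complex_of_complex_def)

lemma conjugate_add: "conjugate (x + y) = conjugate x + conjugate y"
  by (simp add: complex_of_conjugate complex_of_add flip: complex_of_inject)

(* A Hilbert space over 'k: the norm, its topology and completeness come from the class
   banach; the product ip, linear in its first argument, induces that norm. *)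

locale hilbert_space = vector_space scale
  for scale :: "'k::real_or_complex \<Rightarrow> 'a::banach \<Rightarrow> 'a" +
  fixes ip :: "'a \<Rightarrow> 'a \<Rightarrow> 'k"
  assumes scale_of_real: "scale (of_real r) x = r *\<^sub>R x"
    and ip_commute: "ip x y = conjugate (ip y x)"
    and ip_add_left: "ip (x + y) z = ip x z + ip y z"
    and ip_scale_left: "ip (scale c x) y = c * ip x y"
    and ip_self: "ip x x = of_real ((norm x)\<^sup>2)"
begin

lemma ip_add_right: "ip x (y + z) = ip x y + ip x z"
  by (metis ip_commute ip_add_left conjugate_add)

lemma ip_diff_right: "ip x (y - z) = ip x y - ip x z"
  using ip_add_right[of x "y - z" z] by simp

lemma ip_right_eqI:
  assumes "\<And>x. ip x y = ip x z"
  shows "y = z"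
proof -
  have "ip (y - z) (y - z) = 0"
    using assms by (simp add: ip_diff_right)
  then show ?thesis by (simp add: ip_self)
qed

end

lemma hilbert_space_real:
  "hilbert_space (scaleR :: real \<Rightarrow> 'a \<Rightarrow> 'a::{banach, real_inner}) inner"
  by unfold_locales
    (auto simp: conjugate_real inner_commute inner_add_left power2_norm_eq_inner algebra_simps)

lemma hilbert_space_complex:
  "hilbert_space ((*) :: complex \<Rightarrow> complex \<Rightarrow> complex) (\<lambda>x y. x * cnj y)"
  by unfold_locales
    (auto simp: conjugate_complex scaleR_conv_of_real algebra_simps complex_norm_square
      simp del: of_real_power)

(* The library norm on a product type is the Hilbertian one, norm_prod_def; the inner
   product below induces it. *)

definition prod_ip ::
  "('a \<Rightarrow> 'a \<Rightarrow> 'k::real_or_complex) \<Rightarrow> ('b \<Rightarrow> 'b \<Rightarrow> 'k) \<Rightarrow> 'a \<times> 'b \<Rightarrow> 'a \<times> 'b \<Rightarrow> 'k"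
  where "prod_ip ip\<^sub>1 ip\<^sub>2 u v = ip\<^sub>1 (fst u) (fst v) + ip\<^sub>2 (snd u) (snd v)"

lemma hilbert_space_prod:
  assumes "hilbert_space s\<^sub>1 ip\<^sub>1" and "hilbert_space s\<^sub>2 ip\<^sub>2"
  shows "hilbert_space (\<lambda>c u. (s\<^sub>1 c (fst u), s\<^sub>2 c (snd u))) (prod_ip ip\<^sub>1 ip\<^sub>2)"
proof -
  interpret h1: hilbert_space s\<^sub>1 ip\<^sub>1 by fact
  interpret h2: hilbert_space s\<^sub>2 ip\<^sub>2 by fact
  show ?thesis
  proof
    show "prod_ip ip\<^sub>1 ip\<^sub>2 x y = conjugate (prod_ip ip\<^sub>1 ip\<^sub>2 y x)" for x y
      using h1.ip_commute h2.ip_commute by (metis prod_ip_def conjugate_add)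
    show "prod_ip ip\<^sub>1 ip\<^sub>2 x x = of_real ((norm x)\<^sup>2)" for x
      by (simp add: prod_ip_def h1.ip_self h2.ip_self norm_prod_def)
  qed (auto simp: prod_ip_def h1.scale_of_real h2.scale_of_real
      h1.ip_add_left h2.ip_add_left h1.ip_scale_left h2.ip_scale_left scaleR_prod_def
      algebra_simps)
qed

definition linear_maps ::
  "('k::field \<Rightarrow> 'a::ab_group_add \<Rightarrow> 'a) \<Rightarrow> ('k \<Rightarrow> 'b::ab_group_add \<Rightarrow> 'b) \<Rightarrow> ('a \<Rightarrow> 'b) set"
  where "linear_maps s\<^sub>1 s\<^sub>2 = {T. Vector_Spaces.linear s\<^sub>1 s\<^sub>2 T}"

definition continuous_linear_maps ::
  "('k::field \<Rightarrow> 'a \<Rightarrow> 'a) \<Rightarrow> ('k \<Rightarrow> 'b \<Rightarrow> 'b) \<Rightarrow>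
    ('a::{ab_group_add, topological_space} \<Rightarrow> 'b::{ab_group_add, topological_space}) set"
  where "continuous_linear_maps s\<^sub>1 s\<^sub>2 = {T \<in> linear_maps s\<^sub>1 s\<^sub>2. continuous_on UNIV T}"

definition null_space :: "('a \<Rightarrow> 'b::zero) \<Rightarrow> 'a set"
  where "null_space T = {x. T x = 0}"

(* The adjoint in the library is for real inner products only. *)

definition hilbert_adjoint ::
  "('a \<Rightarrow> 'a \<Rightarrow> 'k) \<Rightarrow> ('b \<Rightarrow> 'b \<Rightarrow> 'k) \<Rightarrow> ('a \<Rightarrow> 'b) \<Rightarrow> 'b \<Rightarrow> 'a"
  where "hilbert_adjoint ip\<^sub>1 ip\<^sub>2 T = (THE S. \<forall>x y. ip\<^sub>2 (T x) y = ip\<^sub>1 x (S y))"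

lemma hilbert_adjoint_eqI:
  assumes "hilbert_space s\<^sub>1 ip\<^sub>1"
    and S: "\<And>x y. ip\<^sub>2 (T x) y = ip\<^sub>1 x (S y)"
  shows "hilbert_adjoint ip\<^sub>1 ip\<^sub>2 T = S"
  unfolding hilbert_adjoint_def
proof (rule the_equality)
  show "\<forall>x y. ip\<^sub>2 (T x) y = ip\<^sub>1 x (S y)" using S by blast
next
  fix S' assume "\<forall>x y. ip\<^sub>2 (T x) y = ip\<^sub>1 x (S' y)"
  then have "ip\<^sub>1 x (S' y) = ip\<^sub>1 x (S y)" for x y by (simp flip: S)
  then show "S' = S" by (intro ext) (rule hilbert_space.ip_right_eqI[OF assms(1)])
qed

end

theory Submission
  imports Defs
begin

text \<open>
  The equivalences are Douglas' factorisation lemma together with linear algebra, and the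
  necessary condition comes from duality.

  For continuous linear maps \<open>T\<close> and \<open>U\<close> into the same Hilbert space, a factorisation
  \<open>T = U \<circ> C\<close> dualises to \<open>T\<^sup>* = C\<^sup>* \<circ> U\<^sup>*\<close> and back, and the second form gives
  \<open>norm (T\<^sup>* y) \<le> K * norm (U\<^sup>* y)\<close>. Conversely, such a bound says that for each \<open>x\<close> the functional
  that sends \<open>U\<^sup>* y\<close> to \<open>\<langle>y, T x\<rangle>\<close> is well defined and bounded on the range of \<open>U\<^sup>*\<close>; the vector
  representing it is \<open>C x\<close> (\<open>factor_if_adjoint_majorised\<close>). Both this and the existence of
  adjoints rest on one version of the Riesz theorem, \<open>riesz_representation_along\<close>, which handles
  functionals given on the range of a linear map. The kernel inclusion, on the other hand,
  is equivalent to a factorisation without continuity, by the choice of a basis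
  (\<open>null_space_subset_iff_factor\<close>).

  The approximation property contains two facts. The range of \<open>A\<^sub>1\<close> lies in that of \<open>B\<^sub>1\<close>, which
  by uniform boundedness gives the bound on adjoints (\<open>adjoint_majorised_if_range_subset\<close>). And
  the range of \<open>A\<close> lies in the closure of that of \<open>B\<close>, so that everything orthogonal to the range
  of \<open>B\<close> is orthogonal to the range of \<open>A\<close>; this is the inclusion of the kernels of the adjoints
  (\<open>adjoint_null_space_subset_if_approximable\<close>).

  The scalars are real or complex, so real parts and conjugates are taken through \<open>complex_of\<close>.
\<close>

section \<open>The scalar field\<close>

lemma complex_of_eqI: "complex_of c = complex_of d \<Longrightarrow> c = d"
  by (simp add: complex_of_inject)

lemma complex_of_0 [simp]: "complex_of (0 :: 'k::real_or_complex) = 0"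
  using norm_complex_of[of "0 :: 'k"] by simp

lemma complex_of_1 [simp]: "complex_of (1 :: 'k::real_or_complex) = 1"
proof -
  have "complex_of (1 :: 'k) * complex_of (1 :: 'k) = complex_of (1 :: 'k)"
    by (simp flip: complex_of_mult)
  moreover have "complex_of (1 :: 'k) \<noteq> 0"
    using norm_complex_of[of "1 :: 'k"] by auto
  ultimately show ?thesis by simp
qed

lemma complex_of_of_real [simp]: "complex_of (of_real r :: 'k::real_or_complex) = of_real r"
  by (simp add: of_real_def complex_of_scaleR)

lemma bounded_linear_complex_of: "bounded_linear (complex_of :: 'k::real_or_complex \<Rightarrow> complex)"
  by (rule bounded_linear_intro[where K = 1])
    (simp_all add: complex_of_add complex_of_scaleR norm_complex_of)

lemma norm_conjugate [simp]: "norm (conjugate (c :: 'k::real_or_complex)) = norm c"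
  by (metis norm_complex_of complex_of_conjugate complex_mod_cnj)

lemma conjugate_mult: "conjugate (c * d) = conjugate c * conjugate d"
  by (rule complex_of_eqI) (simp add: complex_of_conjugate complex_of_mult)

lemma conjugate_mult_self: "conjugate c * c = of_real ((norm (c :: 'k::real_or_complex))\<^sup>2)"
proof -
  have "complex_of (conjugate c * c) = complex_of c * cnj (complex_of c)"
    unfolding complex_of_mult complex_of_conjugate by (rule mult.commute)
  also have "\<dots> = of_real ((norm (complex_of c))\<^sup>2)"
    by (rule complex_norm_square[symmetric])
  finally have "complex_of (conjugate c * c) = complex_of (of_real ((norm c)\<^sup>2) :: 'k)"
    by (simp only: complex_of_of_real norm_complex_of)
  then show ?thesis by (rule complex_of_eqI)
qed

section \<open>Elementary Hilbert space geometry\<close>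

context hilbert_space
begin

lemma ip_scale_right: "ip x (scale c y) = conjugate c * ip x y"
  by (metis ip_commute ip_scale_left conjugate_mult)

lemma ip_0_right [simp]: "ip x 0 = 0"
  using ip_add_right[of x 0 0] by simp

lemma ip_diff_left: "ip (x - y) z = ip x z - ip y z"
  using ip_add_left[of "x - y" y z] by simp

lemma ip_self_eq_0D: "ip x x = 0 \<Longrightarrow> x = 0"
  by (simp add: ip_self)

lemma norm_scale: "norm (scale c x) = norm c * norm x"
proof -
  have "ip (scale c x) (scale c x) = of_real ((norm c)\<^sup>2) * ip x x"
    unfolding conjugate_mult_self[symmetric] by (simp add: ip_scale_left ip_scale_right mult_ac)
  then have "(norm (scale c x))\<^sup>2 = (norm c * norm x)\<^sup>2"
    unfolding ip_self of_real_mult[symmetric] of_real_eq_iff power_mult_distrib .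
  then show ?thesis by (rule power2_eq_imp_eq) auto
qed

definition re where "re x y = Re (complex_of (ip x y))"

lemma norm_add_square: "(norm (x + y))\<^sup>2 = (norm x)\<^sup>2 + 2 * re x y + (norm y)\<^sup>2"
proof -
  have norm_sq: "(norm u)\<^sup>2 = Re (complex_of (ip u u))" for u
    unfolding ip_self complex_of_of_real Re_complex_of_real ..
  have "re y x = re x y"
    unfolding re_def by (subst ip_commute) (simp add: complex_of_conjugate)
  then show ?thesis
    unfolding norm_sq re_def ip_add_left ip_add_right complex_of_add plus_complex.sel by simp
qed

lemma parallelogram: "(norm (x + y))\<^sup>2 + (norm (x - y))\<^sup>2 = 2 * (norm x)\<^sup>2 + 2 * (norm y)\<^sup>2"
  for x y :: 'a
proof -
  have "re x y + re x (- y) = re x (y + - y)"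
    unfolding re_def ip_add_right complex_of_add plus_complex.sel ..
  then have "re x (- y) = - re x y" by (simp add: re_def)
  then show ?thesis
    using norm_add_square[of x y] norm_add_square[of x "- y"] by simp
qed

text \<open>The triangle inequality already holds in the ambient normed space, so the polarisation
  identity turns it into a bound on the real part of the inner product; rotating \<open>x\<close> by a unit
  scalar then makes the inner product real and nonnegative.\<close>
lemma Cauchy_Schwarz: "norm (ip x y) \<le> norm x * norm y"
proof (cases "ip x y = 0")
  case False
  have re_le: "re u v \<le> norm u * norm v" for u v
  proof -
    have "(norm (u + v))\<^sup>2 \<le> (norm u + norm v)\<^sup>2"
      by (simp add: norm_triangle_ineq power_mono)
    then show ?thesis
      by (simp add: norm_add_square power2_sum)
  qed
  define c where "c = of_real (norm (ip x y)) / ip x y"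
  have "norm c = 1" using False by (simp add: c_def norm_divide)
  moreover have "ip (scale c x) y = of_real (norm (ip x y))"
    using False by (simp add: c_def ip_scale_left)
  ultimately show ?thesis
    using re_le[of "scale c x" y] by (simp add: re_def norm_scale)
qed simp

lemma bounded_linear_ip_left: "bounded_linear (\<lambda>x. ip x y)"
proof (rule bounded_linear_intro)
  show "ip (r *\<^sub>R x) y = r *\<^sub>R ip x y" for r x
    unfolding scale_of_real[symmetric] ip_scale_left scaleR_conv_of_real ..
qed (rule ip_add_left Cauchy_Schwarz)+

lemma continuous_on_ip_left: "continuous_on S (\<lambda>x. ip x y)"
  using linear_continuous_on[OF bounded_linear_ip_left] .

lemma ip_closure_eq_0:
  assumes "\<And>v. v \<in> V \<Longrightarrow> ip v u = 0" and "z \<in> closure V"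
  shows "ip z u = 0"
proof -
  have "closed {x. ip x u = 0}"
    by (intro closed_Collect_eq continuous_on_ip_left continuous_on_const)
  then have "closure V \<subseteq> {x. ip x u = 0}"
    using assms(1) by (intro closure_minimal) auto
  then show ?thesis using assms(2) by auto
qed

section \<open>Riesz representation along a linear map\<close>

text \<open>A functional \<open>g\<close> dominated by a linear map \<open>L\<close> factors through \<open>L\<close> as a bounded functional on
  the range of \<open>L\<close>, so it is represented by a vector in the closure of that range. No
  extension of the functional to the closure is made: the vector is the limit of the
  \<open>L y\<close> along a sequence minimising \<open>(norm (L y))\<^sup>2 - 2 Re (g y)\<close>, which is
  \<open>(norm (L y - z))\<^sup>2 - (norm z)\<^sup>2\<close> for the vector \<open>z\<close> sought. With \<open>L\<close> the identity this is the
  Riesz representation theorem; with \<open>L\<close> an adjoint it yields factorisations of operators.\<close>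
lemma riesz_representation_along:
  assumes L: "Vector_Spaces.linear s scale L" and g: "Vector_Spaces.linear s (*) g"
    and bound: "\<And>y. norm (g y) \<le> K * norm (L y)"
  obtains z where "z \<in> closure (range L)" and "\<And>y. g y = ip (L y) z" and "norm z \<le> \<bar>K\<bar>"
proof -
  have L_add: "L (x + y) = L x + L y" and L_scale: "L (s c x) = scale c (L x)"
    and g_add: "g (x + y) = g x + g y" and g_scale: "g (s c x) = c * g x" for x y c
    using L g unfolding Vector_Spaces.linear_iff by blast+
  define G where "G y = Re (complex_of (g y))" for y
  have G_add: "G (x + y) = G x + G y" for x y
    by (simp add: G_def g_add complex_of_add)
  define J where "J y = (norm (L y))\<^sup>2 - 2 * G y" for y
  have J_lower: "J y \<ge> - K\<^sup>2" for y
  proof -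
    have "G y \<le> norm (g y)"
      unfolding G_def using complex_Re_le_cmod[of "complex_of (g y)"] by (simp add: norm_complex_of)
    also have "\<dots> \<le> K * norm (L y)" by (rule bound)
    finally show ?thesis
      using zero_le_power2[of "norm (L y) - K"] unfolding J_def power2_diff by (simp add: algebra_simps)
  qed
  define d where "d = Inf (range J)"
  have bdd: "bdd_below (range J)" using J_lower by (auto simp: bdd_below_def)
  then have d_le: "d \<le> J y" for y unfolding d_def by (simp add: cINF_lower)
  have "\<exists>y. J y < d + inverse (real (Suc n))" for n
    using cInf_lessD[of "range J" "d + inverse (real (Suc n))"] by (auto simp: d_def)
  then obtain a where a: "\<And>n. J (a n) < d + inverse (real (Suc n))" by metis
  have J_lim: "(\<lambda>n. J (a n)) \<longlonglongrightarrow> d"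
  proof (rule tendsto_sandwich[OF _ _ tendsto_const])
    show "(\<lambda>n. d + inverse (real (Suc n))) \<longlonglongrightarrow> d"
      using tendsto_add[OF tendsto_const LIMSEQ_inverse_real_of_nat] by simp
  qed (use d_le a in \<open>auto intro!: always_eventually less_imp_le\<close>)
  \<comment> \<open>Near-minimisers of \<open>J\<close> have nearby images under \<open>L\<close>, because their midpoint
     cannot do better than the infimum \<open>d\<close>.\<close>
  have J_midpoint: "(norm (L x - L y))\<^sup>2 \<le> 2 * (J x - d) + 2 * (J y - d)" for x y
  proof -
    define m where "m = s (of_real (1/2)) (x + y)"
    have Lm: "L m = (1/2) *\<^sub>R (L x + L y)" 
      unfolding m_def L_scale L_add scale_of_real ..
    have gm: "g m = of_real (1/2) * (g x + g y)"
      unfolding m_def g_scale g_add ..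
    have "G m = (G x + G y) / 2"
      unfolding G_def gm complex_of_mult complex_of_of_real complex_of_add by simp
    moreover have "(norm (L m))\<^sup>2 = (norm (L x + L y))\<^sup>2 / 4"
      unfolding Lm by (simp add: power_mult_distrib power2_eq_square)
    ultimately have "4 * d \<le> (norm (L x + L y))\<^sup>2 - 4 * (G x + G y)"
      using d_le[of m] by (simp add: J_def)
    then show ?thesis
      using parallelogram[of "L x" "L y"] by (simp add: J_def algebra_simps)
  qed
  have "Cauchy (\<lambda>n. L (a n))"
  proof (rule CauchyI)
    fix e :: real assume "e > 0"
    then have "d < d + e\<^sup>2 / 4" by simp
    then obtain N where N: "\<And>n. n \<ge> N \<Longrightarrow> J (a n) < d + e\<^sup>2 / 4"
      using order_tendstoD(2)[OF J_lim] unfolding eventually_sequentially by blast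
    show "\<exists>M. \<forall>m\<ge>M. \<forall>n\<ge>M. norm (L (a m) - L (a n)) < e"
    proof (intro exI[of _ N] allI impI)
      fix m n assume "m \<ge> N" "n \<ge> N"
      then have "J (a m) - d < e\<^sup>2 / 4" "J (a n) - d < e\<^sup>2 / 4"
        using N[of m] N[of n] by simp_all
      then have "(norm (L (a m) - L (a n)))\<^sup>2 < e\<^sup>2"
        using J_midpoint[of "a m" "a n"] by argo
      then show "norm (L (a m) - L (a n)) < e"
        using \<open>e > 0\<close> by (simp add: power2_less_imp_less)
    qed
  qed
  then obtain z where z: "(\<lambda>n. L (a n)) \<longlonglongrightarrow> z"
    by (auto simp: Cauchy_convergent_iff convergent_def)
  have z_closure: "z \<in> closure (range L)"
    unfolding closure_sequential by (intro exI[of _ "\<lambda>n. L (a n)"] conjI z) simp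
  have re_lim: "(\<lambda>n. re (L (a n)) u) \<longlonglongrightarrow> re z u" for u
    unfolding re_def
    by (intro tendsto_Re bounded_linear.tendsto[OF bounded_linear_complex_of]
        bounded_linear.tendsto[OF bounded_linear_ip_left] z)
  have variation: "2 * G w \<le> 2 * re z (L w) + (norm (L w))\<^sup>2" for w
  proof -
    have "d \<le> J (a n) + (2 * re (L (a n)) (L w) + (norm (L w))\<^sup>2 - 2 * G w)" for n
      using d_le[of "a n + w"] norm_add_square[of "L (a n)" "L w"] by (simp add: J_def L_add G_add)
    moreover have "(\<lambda>n. J (a n) + (2 * re (L (a n)) (L w) + (norm (L w))\<^sup>2 - 2 * G w))
        \<longlonglongrightarrow> d + (2 * re z (L w) + (norm (L w))\<^sup>2 - 2 * G w)"
      by (intro tendsto_intros J_lim re_lim)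
    ultimately have "d \<le> d + (2 * re z (L w) + (norm (L w))\<^sup>2 - 2 * G w)"
      by (intro LIMSEQ_le_const) auto
    then show ?thesis by simp
  qed
  have rep: "g w = ip (L w) z" for w
  proof -
    define e where "e = g w - ip (L w) z"
    define t where "t = 1 / (1 + (norm (L w))\<^sup>2)"
    define c where "c = of_real t * conjugate e"
    have t: "t > 0" "t * (norm (L w))\<^sup>2 \<le> 1"
      unfolding t_def by (auto simp: add_pos_nonneg divide_le_eq)
    \<comment> \<open>Moving in direction \<open>s c w\<close> lowers \<open>J\<close> by \<open>2 * t * (norm e)\<^sup>2\<close> to first order and raises it
       by \<open>t\<^sup>2 * (norm e)\<^sup>2 * (norm (L w))\<^sup>2\<close> to second order; the choice of \<open>t\<close> lets the first win
       unless \<open>e = 0\<close>.\<close>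
    have "re z (L (s c w)) = re (L (s c w)) z"
      unfolding re_def by (subst ip_commute) (simp add: complex_of_conjugate)
    moreover have "G (s c w) - re (L (s c w)) z = t * (norm e)\<^sup>2"
    proof -
      have "g (s c w) = c * e + ip (L (s c w)) z"
        by (simp add: g_scale L_scale ip_scale_left e_def algebra_simps)
      moreover have "c * e = of_real (t * (norm e)\<^sup>2)"
        unfolding c_def mult.assoc conjugate_mult_self by simp
      ultimately show ?thesis
        unfolding G_def re_def by (simp only: complex_of_add complex_of_of_real) simp
    qed
    moreover have "(norm (L (s c w)))\<^sup>2 = t\<^sup>2 * (norm e)\<^sup>2 * (norm (L w))\<^sup>2"
      using t by (simp add: L_scale norm_scale c_def norm_mult power_mult_distrib)
    ultimately have "t * (2 * (norm e)\<^sup>2) \<le> t * ((t * (norm (L w))\<^sup>2) * (norm e)\<^sup>2)"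
      using variation[of "s c w"] by (simp add: power2_eq_square mult_ac)
    then have "2 * (norm e)\<^sup>2 \<le> (t * (norm (L w))\<^sup>2) * (norm e)\<^sup>2"
      using t by simp
    also have "\<dots> \<le> 1 * (norm e)\<^sup>2"
      using t by (intro mult_right_mono) auto
    finally have "e = 0" by simp
    then show ?thesis by (simp add: e_def)
  qed
  have "norm z \<le> \<bar>K\<bar>"
  proof (cases "z = 0")
    case False
    have "closed {x. norm (ip x z) \<le> \<bar>K\<bar> * norm x}"
      by (intro closed_Collect_le continuous_intros continuous_on_ip_left)
    moreover have "norm (ip (L y) z) \<le> \<bar>K\<bar> * norm (L y)" for y
      using bound[of y] by (metis rep abs_ge_self mult_right_mono norm_ge_zero order_trans)
    ultimately have "closure (range L) \<subseteq> {x. norm (ip x z) \<le> \<bar>K\<bar> * norm x}"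
      by (intro closure_minimal) auto
    then have "norm (ip z z) \<le> \<bar>K\<bar> * norm z" using z_closure by auto
    then show ?thesis using False by (simp add: ip_self power2_eq_square norm_mult)
  qed simp
  then show ?thesis using that z_closure rep by blast
qed

section \<open>Uniform boundedness\<close>

text \<open>This is the Banach--Steinhaus theorem for the functionals given by a set of vectors. By Baire,
  one of the closed sets of points where the functionals are bounded by \<open>n\<close> contains a ball; testing
  at its centre and at a point displaced towards a vector of the set bounds the norm of
  that vector.\<close>
lemma uniform_boundedness:
  assumes pointwise: "\<And>h. \<exists>K. \<forall>v\<in>S. norm (ip h v) \<le> K"
  shows "\<exists>C. \<forall>v\<in>S. norm v \<le> C"
proof -
  define F where "F n = {h. \<forall>v\<in>S. norm (ip h v) \<le> real n}" for n
  have closed_F: "closed (F n)" for n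
  proof -
    have "F n = (\<Inter>v\<in>S. {h. norm (ip h v) \<le> real n})" by (auto simp: F_def)
    then show ?thesis
      by (auto intro!: closed_INT closed_Collect_le continuous_intros continuous_on_ip_left)
  qed
  have "(\<Union>n. F n) = UNIV"
  proof -
    have "h \<in> (\<Union>n. F n)" for h
    proof -
      obtain K where K: "\<forall>v\<in>S. norm (ip h v) \<le> K" using pointwise by blast
      obtain n where "K \<le> real n" using real_arch_simple by blast
      then have "h \<in> F n" using K order_trans by (fastforce simp: F_def)
      then show ?thesis by blast
    qed
    then show ?thesis by blast
  qed
  then have "\<exists>n. interior (F n) \<noteq> {}"
    using Baire_category_alt[OF disjI1[OF completely_metrizable_space_euclidean], of "range F"] closed_F
    by (simp add: interior_of_eq) blast
  then obtain n h0 where "h0 \<in> interior (F n)" by blast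
  then obtain r where r: "r > 0" "cball h0 r \<subseteq> F n"
    by (auto simp: mem_interior_cball)
  have "norm v \<le> 2 * real n / r" if "v \<in> S" for v
  proof (cases "v = 0")
    case False
    define u where "u = (r / norm v) *\<^sub>R v"
    have "norm u = r" using False r by (simp add: u_def)
    then have "h0 + u \<in> F n" "h0 \<in> F n" using r by (auto simp: dist_norm intro!: subsetD[OF r(2)])
    then have "norm (ip (h0 + u) v) \<le> real n" "norm (ip h0 v) \<le> real n"
      using that by (auto simp: F_def)
    moreover have "ip u v = ip (h0 + u) v - ip h0 v" by (simp add: ip_add_left)
    ultimately have "norm (ip u v) \<le> 2 * real n"
      by (metis norm_triangle_le_diff mult_2 add_mono)
    moreover have "ip u v = of_real (r * norm v)"
      unfolding u_def scale_of_real[symmetric] ip_scale_left ip_self of_real_mult[symmetric]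
      using False by (simp add: power2_eq_square)
    ultimately have "r * norm v \<le> 2 * real n" using r by (simp add: norm_mult)
    then show ?thesis using r by (simp add: field_simps)
  qed (use r in simp)
  then show ?thesis by blast
qed

end

section \<open>Continuous linear maps and their adjoints\<close>

lemma linear_norm_bound_iff_continuous:
  assumes "hilbert_space s\<^sub>1 ip\<^sub>1" and "hilbert_space s\<^sub>2 ip\<^sub>2" and T: "Vector_Spaces.linear s\<^sub>1 s\<^sub>2 T"
  shows "continuous_on UNIV T \<longleftrightarrow> (\<exists>K. \<forall>x. norm (T x) \<le> norm x * K)"
proof
  interpret h1: hilbert_space s\<^sub>1 ip\<^sub>1 by fact
  interpret h2: hilbert_space s\<^sub>2 ip\<^sub>2 by fact
  have T_add: "T (x + y) = T x + T y" and T_scale: "T (s\<^sub>1 c x) = s\<^sub>2 c (T x)" for x y c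
    using T unfolding Vector_Spaces.linear_iff by blast+
  have T_scaleR: "T (r *\<^sub>R x) = r *\<^sub>R T x" for r x
    unfolding h1.scale_of_real[symmetric] h2.scale_of_real[symmetric] by (rule T_scale)
  {
    assume "\<exists>K. \<forall>x. norm (T x) \<le> norm x * K"
    then obtain K where "\<And>x. norm (T x) \<le> norm x * K" by blast
    then have "bounded_linear T"
      by (intro bounded_linear_intro T_add T_scaleR)
    then show "continuous_on UNIV T" by (rule linear_continuous_on)
  next
    assume "continuous_on UNIV T"
    moreover have "T 0 = 0" using T_scaleR[of 0 0] by simp
    ultimately obtain d where d: "d > 0" "\<And>x. norm x < d \<Longrightarrow> norm (T x) < 1"
      unfolding continuous_on_iff dist_norm by (metis UNIV_I diff_zero zero_less_one)
    have "norm (T x) \<le> norm x * (2 / d)" for x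
    proof (cases "x = 0")
      case False
      define r where "r = d / (2 * norm x)"
      have r: "r > 0" using False d by (simp add: r_def)
      have "norm (r *\<^sub>R x) < d" using False d by (simp add: r_def)
      then have "r * norm (T x) < 1" using d(2)[of "r *\<^sub>R x"] r by (simp add: T_scaleR)
      then show ?thesis using False d by (simp add: r_def field_simps)
    qed (use \<open>T 0 = 0\<close> in simp)
    then show "\<exists>K. \<forall>x. norm (T x) \<le> norm x * K" by blast
  }
qed

lemma continuous_linear_maps_bounded:
  assumes "hilbert_space s\<^sub>1 ip\<^sub>1" and "hilbert_space s\<^sub>2 ip\<^sub>2" and "T \<in> continuous_linear_maps s\<^sub>1 s\<^sub>2"
  obtains K where "K > 0" and "\<And>x. norm (T x) \<le> K * norm x"
proof -
  obtain K where K: "\<And>x. norm (T x) \<le> norm x * K"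
    using linear_norm_bound_iff_continuous[OF assms(1,2), of T] assms(3)
    by (auto simp: continuous_linear_maps_def linear_maps_def)
  have "norm (T x) \<le> (\<bar>K\<bar> + 1) * norm x" for x
  proof -
    have "norm x * K \<le> norm x * (\<bar>K\<bar> + 1)" by (intro mult_left_mono) auto
    then show ?thesis using K[of x] by (simp add: mult.commute)
  qed
  then show ?thesis using that[of "\<bar>K\<bar> + 1"] by simp
qed

lemma continuous_linear_mapsI:
  assumes "hilbert_space s\<^sub>1 ip\<^sub>1" and "hilbert_space s\<^sub>2 ip\<^sub>2"
    and "\<And>x y. T (x + y) = T x + T y" and "\<And>c x. T (s\<^sub>1 c x) = s\<^sub>2 c (T x)"
    and "\<And>x. norm (T x) \<le> K * norm x"
  shows "T \<in> continuous_linear_maps s\<^sub>1 s\<^sub>2"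
proof -
  have "Vector_Spaces.linear s\<^sub>1 s\<^sub>2 T"
    using assms by (simp add: Vector_Spaces.linear_iff hilbert_space_def)
  moreover have "continuous_on UNIV T"
    using linear_norm_bound_iff_continuous[OF assms(1,2) calculation] assms(5)
    by (auto simp: mult.commute)
  ultimately show ?thesis by (simp add: continuous_linear_maps_def linear_maps_def)
qed

lemma continuous_linear_maps_linear:
  assumes "T \<in> continuous_linear_maps s\<^sub>1 s\<^sub>2"
  shows "Vector_Spaces.linear s\<^sub>1 s\<^sub>2 T"
    and "T (x + y) = T x + T y" and "T (s\<^sub>1 c x) = s\<^sub>2 c (T x)"
  using assms by (simp_all add: continuous_linear_maps_def linear_maps_def Vector_Spaces.linear_iff)

lemma continuous_linear_maps_Pair:
  assumes "T \<in> continuous_linear_maps s s\<^sub>1" and "U \<in> continuous_linear_maps s s\<^sub>2"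
    and "hilbert_space s\<^sub>1 ip\<^sub>1" and "hilbert_space s\<^sub>2 ip\<^sub>2"
  shows "(\<lambda>x. (T x, U x)) \<in> continuous_linear_maps s (\<lambda>c u. (s\<^sub>1 c (fst u), s\<^sub>2 c (snd u)))"
  using assms hilbert_space_prod[OF assms(3,4)]
  by (auto simp: continuous_linear_maps_def linear_maps_def Vector_Spaces.linear_iff hilbert_space_def
      intro!: continuous_on_Pair)

lemma ip_hilbert_adjoint:
  assumes h1: "hilbert_space s\<^sub>1 ip\<^sub>1" and h2: "hilbert_space s\<^sub>2 ip\<^sub>2"
    and T: "T \<in> continuous_linear_maps s\<^sub>1 s\<^sub>2"
  shows "ip\<^sub>2 (T x) y = ip\<^sub>1 x (hilbert_adjoint ip\<^sub>1 ip\<^sub>2 T y)"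
proof -
  interpret h1: hilbert_space s\<^sub>1 ip\<^sub>1 by fact
  interpret h2: hilbert_space s\<^sub>2 ip\<^sub>2 by fact
  obtain K where K: "\<And>x. norm (T x) \<le> K * norm x"
    using continuous_linear_maps_bounded[OF h1 h2 T] by blast
  have "\<exists>z. \<forall>x. ip\<^sub>2 (T x) y = ip\<^sub>1 x z" for y
  proof -
    have "Vector_Spaces.linear s\<^sub>1 (*) (\<lambda>x. ip\<^sub>2 (T x) y)"
      by (simp add: Vector_Spaces.linear_iff h1.vector_space_axioms vector_space_over_itself.vector_space_axioms
          continuous_linear_maps_linear(2,3)[OF T] h2.ip_add_left h2.ip_scale_left)
    moreover have "norm (ip\<^sub>2 (T x) y) \<le> (K * norm y) * norm x" for x
      using order_trans[OF h2.Cauchy_Schwarz mult_right_mono[OF K norm_ge_zero]]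
      by (simp add: mult_ac)
    ultimately show ?thesis
      using h1.riesz_representation_along[OF h1.linear_ident] by metis
  qed
  then obtain S where S: "\<And>x y. ip\<^sub>2 (T x) y = ip\<^sub>1 x (S y)" by metis
  then show ?thesis using hilbert_adjoint_eqI[of s\<^sub>1 ip\<^sub>1 ip\<^sub>2 T S] h1 by simp
qed

lemma ip_hilbert_adjoint':
  assumes h1: "hilbert_space s\<^sub>1 ip\<^sub>1" and h2: "hilbert_space s\<^sub>2 ip\<^sub>2"
    and T: "T \<in> continuous_linear_maps s\<^sub>1 s\<^sub>2"
  shows "ip\<^sub>1 (hilbert_adjoint ip\<^sub>1 ip\<^sub>2 T y) x = ip\<^sub>2 y (T x)"
  by (metis hilbert_space.ip_commute[OF h1] hilbert_space.ip_commute[OF h2] ip_hilbert_adjoint[OF assms])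

lemma hilbert_adjoint_continuous_linear:
  assumes h1: "hilbert_space s\<^sub>1 ip\<^sub>1" and h2: "hilbert_space s\<^sub>2 ip\<^sub>2"
    and T: "T \<in> continuous_linear_maps s\<^sub>1 s\<^sub>2"
  shows "hilbert_adjoint ip\<^sub>1 ip\<^sub>2 T \<in> continuous_linear_maps s\<^sub>2 s\<^sub>1"
proof -
  interpret h1: hilbert_space s\<^sub>1 ip\<^sub>1 by fact
  interpret h2: hilbert_space s\<^sub>2 ip\<^sub>2 by fact
  note adj = ip_hilbert_adjoint[OF assms]
  obtain K where "K > 0" and K: "\<And>x. norm (T x) \<le> K * norm x"
    using continuous_linear_maps_bounded[OF h1 h2 T] by blast
  let ?S = "hilbert_adjoint ip\<^sub>1 ip\<^sub>2 T"
  have "norm (?S y) \<le> K * norm y" for y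
  proof (cases "?S y = 0")
    case False
    have "norm (?S y) * norm (?S y) = norm (ip\<^sub>1 (?S y) (?S y))"
      by (simp add: h1.ip_self power2_eq_square norm_mult)
    also have "\<dots> \<le> norm (T (?S y)) * norm y"
      unfolding adj[symmetric] by (rule h2.Cauchy_Schwarz)
    also have "\<dots> \<le> K * norm (?S y) * norm y"
      by (intro mult_right_mono K norm_ge_zero)
    finally have "norm (?S y) * norm (?S y) \<le> norm (?S y) * (K * norm y)" by (simp add: mult_ac)
    then show ?thesis using False by simp
  qed (use \<open>K > 0\<close> in simp)
  then show ?thesis
    by (intro continuous_linear_mapsI[OF h2 h1, where K = K] h1.ip_right_eqI)
      (simp_all add: h1.ip_add_right h2.ip_add_right h1.ip_scale_right h2.ip_scale_right flip: adj)
qed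

lemma hilbert_adjoint_hilbert_adjoint:
  assumes "hilbert_space s\<^sub>1 ip\<^sub>1" and "hilbert_space s\<^sub>2 ip\<^sub>2"
    and "T \<in> continuous_linear_maps s\<^sub>1 s\<^sub>2"
  shows "hilbert_adjoint ip\<^sub>2 ip\<^sub>1 (hilbert_adjoint ip\<^sub>1 ip\<^sub>2 T) = T"
  by (rule hilbert_adjoint_eqI[OF assms(2)]) (rule ip_hilbert_adjoint'[OF assms])

lemma hilbert_adjoint_comp:
  assumes "hilbert_space s\<^sub>1 ip\<^sub>1" and "hilbert_space s\<^sub>2 ip\<^sub>2" and "hilbert_space s\<^sub>3 ip\<^sub>3"
    and "T \<in> continuous_linear_maps s\<^sub>1 s\<^sub>2" and "U \<in> continuous_linear_maps s\<^sub>2 s\<^sub>3"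
  shows "hilbert_adjoint ip\<^sub>1 ip\<^sub>3 (U \<circ> T) = hilbert_adjoint ip\<^sub>1 ip\<^sub>2 T \<circ> hilbert_adjoint ip\<^sub>2 ip\<^sub>3 U"
  by (rule hilbert_adjoint_eqI[OF assms(1)])
    (simp add: ip_hilbert_adjoint[OF assms(1,2,4)] ip_hilbert_adjoint[OF assms(2,3,5)])

lemma hilbert_adjoint_Pair:
  assumes h: "hilbert_space s ip" and h1: "hilbert_space s\<^sub>1 ip\<^sub>1" and h2: "hilbert_space s\<^sub>2 ip\<^sub>2"
    and T: "T \<in> continuous_linear_maps s s\<^sub>1" and U: "U \<in> continuous_linear_maps s s\<^sub>2"
  shows "hilbert_adjoint ip (prod_ip ip\<^sub>1 ip\<^sub>2) (\<lambda>x. (T x, U x)) =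
    (\<lambda>u. hilbert_adjoint ip ip\<^sub>1 T (fst u) + hilbert_adjoint ip ip\<^sub>2 U (snd u))"
  by (rule hilbert_adjoint_eqI[OF h])
    (simp add: prod_ip_def hilbert_space.ip_add_right[OF h]
      ip_hilbert_adjoint[OF h h1 T] ip_hilbert_adjoint[OF h h2 U])

section \<open>Factorisation and majorisation\<close>

text \<open>Only algebra is involved: a linear right inverse \<open>G\<close> of \<open>L\<close> on its range yields the factor
  \<open>S \<circ> G\<close>, because \<open>x\<close> and \<open>G (L x)\<close> differ by an element of the kernel of \<open>L\<close>. Since \<open>G\<close> comes from
  a basis, the factor need not be continuous.\<close>
lemma null_space_subset_iff_factor:
  assumes L: "Vector_Spaces.linear s s\<^sub>2 L" and S: "Vector_Spaces.linear s s\<^sub>1 S"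
  shows "null_space L \<subseteq> null_space S \<longleftrightarrow> (\<exists>D \<in> linear_maps s\<^sub>2 s\<^sub>1. S = D \<circ> L)"
proof
  interpret L: Vector_Spaces.linear s s\<^sub>2 L by fact
  interpret S: Vector_Spaces.linear s s\<^sub>1 S by fact
  interpret sp: vector_space_pair s s\<^sub>2 ..
  {
    assume null: "null_space L \<subseteq> null_space S"
    obtain G where G: "Vector_Spaces.linear s\<^sub>2 s G" "\<And>x. L (G (L x)) = L x"
      using sp.linear_exists_right_inverse_on[OF L L.vs1.subspace_UNIV] by auto
    have "S x = S (G (L x))" for x
    proof -
      have "L (x - G (L x)) = 0" by (simp add: L.diff G(2))
      then have "S (x - G (L x)) = 0" using null by (auto simp: null_space_def)
      then show ?thesis by (simp add: S.diff)
    qed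
    then have "S = (S \<circ> G) \<circ> L" by (simp add: fun_eq_iff)
    moreover have "S \<circ> G \<in> linear_maps s\<^sub>2 s\<^sub>1"
      using Vector_Spaces.linear_compose[OF G(1) S] by (simp add: linear_maps_def)
    ultimately show "\<exists>D \<in> linear_maps s\<^sub>2 s\<^sub>1. S = D \<circ> L" by blast
  next
    assume "\<exists>D \<in> linear_maps s\<^sub>2 s\<^sub>1. S = D \<circ> L"
    then obtain D where "Vector_Spaces.linear s\<^sub>2 s\<^sub>1 D" "S = D \<circ> L"
      by (auto simp: linear_maps_def)
    moreover from this(1) have "D 0 = 0"
      by (simp add: module_hom.zero flip: module_hom_iff_linear)
    ultimately show "null_space L \<subseteq> null_space S" by (auto simp: null_space_def)
  }
qed

text \<open>This is the harder half of Douglas' lemma. For fixed \<open>x\<close>, the functional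
  \<open>y \<mapsto> \<langle>y, T x\<rangle> = \<langle>T\<^sup>* y, x\<rangle>\<close> is dominated by \<open>U\<^sup>*\<close>, so it is represented along \<open>U\<^sup>*\<close> by a
  vector \<open>C x\<close> in the closure of the range of \<open>U\<^sup>*\<close>. That closure meets the orthogonal
  complement of the range only in zero, which makes \<open>C x\<close> unique and therefore linear in \<open>x\<close>.\<close>
lemma factor_if_adjoint_majorised:
  assumes h1: "hilbert_space s\<^sub>1 ip\<^sub>1" and h2: "hilbert_space s\<^sub>2 ip\<^sub>2" and h3: "hilbert_space s\<^sub>3 ip\<^sub>3"
    and T: "T \<in> continuous_linear_maps s\<^sub>1 s\<^sub>3" and U: "U \<in> continuous_linear_maps s\<^sub>2 s\<^sub>3"
    and major: "\<And>y. norm (hilbert_adjoint ip\<^sub>1 ip\<^sub>3 T y) \<le> K * norm (hilbert_adjoint ip\<^sub>2 ip\<^sub>3 U y)"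
  shows "\<exists>C \<in> continuous_linear_maps s\<^sub>1 s\<^sub>2. T = U \<circ> C"
proof -
  interpret h1: hilbert_space s\<^sub>1 ip\<^sub>1 by fact
  interpret h2: hilbert_space s\<^sub>2 ip\<^sub>2 by fact
  interpret h3: hilbert_space s\<^sub>3 ip\<^sub>3 by fact
  define V where "V = hilbert_adjoint ip\<^sub>2 ip\<^sub>3 U"
  have V: "Vector_Spaces.linear s\<^sub>3 s\<^sub>2 V"
    unfolding V_def
    by (intro continuous_linear_maps_linear(1) hilbert_adjoint_continuous_linear[OF h2 h3 U])
  note T_linear = continuous_linear_maps_linear(2,3)[OF T]
  have "\<exists>z. z \<in> closure (range V) \<and> (\<forall>y. ip\<^sub>3 y (T x) = ip\<^sub>2 (V y) z) \<and> norm z \<le> \<bar>K\<bar> * norm x" for x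
  proof -
    have "Vector_Spaces.linear s\<^sub>3 (*) (\<lambda>y. ip\<^sub>3 y (T x))"
      by (simp add: Vector_Spaces.linear_iff h3.vector_space_axioms
          vector_space_over_itself.vector_space_axioms h3.ip_add_left h3.ip_scale_left)
    moreover have "norm (ip\<^sub>3 y (T x)) \<le> (K * norm x) * norm (V y)" for y
      unfolding ip_hilbert_adjoint'[OF h1 h3 T, symmetric] V_def
      using order_trans[OF h1.Cauchy_Schwarz mult_right_mono[OF major norm_ge_zero]]
      by (simp add: mult_ac)
    ultimately show ?thesis
      using h2.riesz_representation_along[OF V] by (metis abs_mult abs_norm_cancel)
  qed
  then obtain C where C_closure: "\<And>x. C x \<in> closure (range V)"
    and C_ip: "\<And>x y. ip\<^sub>2 (V y) (C x) = ip\<^sub>3 y (T x)"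
    and C_norm: "\<And>x. norm (C x) \<le> \<bar>K\<bar> * norm x"
    by metis
  have orth: "ip\<^sub>2 (C x) u = 0" if "\<And>y. ip\<^sub>2 (V y) u = 0" for x u
    using h2.ip_closure_eq_0[OF _ C_closure] that by blast
  have C_add: "C (x + y) = C x + C y" for x y
  proof -
    define u where "u = C (x + y) - (C x + C y)"
    have "ip\<^sub>2 (V v) u = 0" for v
      by (simp add: u_def h2.ip_diff_right h2.ip_add_right C_ip T_linear h3.ip_add_right)
    then have "ip\<^sub>2 (C w) u = 0" for w by (rule orth)
    then have "ip\<^sub>2 u u = 0"
      by (subst u_def) (simp add: h2.ip_diff_left h2.ip_add_left)
    then show ?thesis using h2.ip_self_eq_0D by (fastforce simp: u_def)
  qed
  have C_scale: "C (s\<^sub>1 c x) = s\<^sub>2 c (C x)" for c x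
  proof -
    define u where "u = C (s\<^sub>1 c x) - s\<^sub>2 c (C x)"
    have "ip\<^sub>2 (V v) u = 0" for v
      by (simp add: u_def h2.ip_diff_right h2.ip_scale_right C_ip T_linear h3.ip_scale_right)
    then have "ip\<^sub>2 (C w) u = 0" for w by (rule orth)
    then have "ip\<^sub>2 u u = 0"
      by (subst u_def) (simp add: h2.ip_diff_left h2.ip_scale_left)
    then show ?thesis using h2.ip_self_eq_0D by (fastforce simp: u_def)
  qed
  have "C \<in> continuous_linear_maps s\<^sub>1 s\<^sub>2"
    by (rule continuous_linear_mapsI[OF h1 h2 C_add C_scale C_norm])
  moreover have "T x = U (C x)" for x
    by (rule h3.ip_right_eqI)
      (simp add: ip_hilbert_adjoint'[OF h2 h3 U, symmetric] C_ip flip: V_def)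
  ultimately show ?thesis by (intro bexI[of _ C]) (auto simp: fun_eq_iff)
qed

lemma factor_iff_adjoint_factor:
  assumes h1: "hilbert_space s\<^sub>1 ip\<^sub>1" and h2: "hilbert_space s\<^sub>2 ip\<^sub>2" and h3: "hilbert_space s\<^sub>3 ip\<^sub>3"
    and T: "T \<in> continuous_linear_maps s\<^sub>1 s\<^sub>3" and U: "U \<in> continuous_linear_maps s\<^sub>2 s\<^sub>3"
  shows "(\<exists>C \<in> continuous_linear_maps s\<^sub>1 s\<^sub>2. T = U \<circ> C) \<longleftrightarrow>
    (\<exists>D \<in> continuous_linear_maps s\<^sub>2 s\<^sub>1. hilbert_adjoint ip\<^sub>1 ip\<^sub>3 T = D \<circ> hilbert_adjoint ip\<^sub>2 ip\<^sub>3 U)"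
    (is "?factor \<longleftrightarrow> ?adjoint_factor")
proof
  assume ?factor
  then show ?adjoint_factor
    using hilbert_adjoint_comp[OF h1 h2 h3 _ U] hilbert_adjoint_continuous_linear[OF h1 h2] by blast
next
  assume ?adjoint_factor
  then obtain D where D: "D \<in> continuous_linear_maps s\<^sub>2 s\<^sub>1"
    and eq: "hilbert_adjoint ip\<^sub>1 ip\<^sub>3 T = D \<circ> hilbert_adjoint ip\<^sub>2 ip\<^sub>3 U"
    by blast
  have "T = hilbert_adjoint ip\<^sub>3 ip\<^sub>1 (D \<circ> hilbert_adjoint ip\<^sub>2 ip\<^sub>3 U)"
    unfolding eq[symmetric] by (rule hilbert_adjoint_hilbert_adjoint[OF h1 h3 T, symmetric])
  also have "\<dots> = U \<circ> hilbert_adjoint ip\<^sub>2 ip\<^sub>1 D"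
    unfolding hilbert_adjoint_comp[OF h3 h2 h1 hilbert_adjoint_continuous_linear[OF h2 h3 U] D]
      hilbert_adjoint_hilbert_adjoint[OF h2 h3 U] ..
  finally show ?factor
    using hilbert_adjoint_continuous_linear[OF h2 h1 D] by blast
qed

lemma factor_iff_adjoint_majorised:
  assumes h1: "hilbert_space s\<^sub>1 ip\<^sub>1" and h2: "hilbert_space s\<^sub>2 ip\<^sub>2" and h3: "hilbert_space s\<^sub>3 ip\<^sub>3"
    and T: "T \<in> continuous_linear_maps s\<^sub>1 s\<^sub>3" and U: "U \<in> continuous_linear_maps s\<^sub>2 s\<^sub>3"
  shows "(\<exists>C \<in> continuous_linear_maps s\<^sub>1 s\<^sub>2. T = U \<circ> C) \<longleftrightarrow>
    (\<exists>K>0. \<forall>y. norm (hilbert_adjoint ip\<^sub>1 ip\<^sub>3 T y) \<le> K * norm (hilbert_adjoint ip\<^sub>2 ip\<^sub>3 U y))"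
    (is "_ \<longleftrightarrow> ?majorised")
proof
  assume "\<exists>C \<in> continuous_linear_maps s\<^sub>1 s\<^sub>2. T = U \<circ> C"
  then obtain D where D: "D \<in> continuous_linear_maps s\<^sub>2 s\<^sub>1"
    and eq: "hilbert_adjoint ip\<^sub>1 ip\<^sub>3 T = D \<circ> hilbert_adjoint ip\<^sub>2 ip\<^sub>3 U"
    using factor_iff_adjoint_factor[OF assms] by blast
  obtain K where "K > 0" "\<And>x. norm (D x) \<le> K * norm x"
    using continuous_linear_maps_bounded[OF h2 h1 D] by blast
  then show ?majorised unfolding eq by auto
qed (use factor_if_adjoint_majorised[OF assms] in blast)

text \<open>On the vectors \<open>T\<^sup>* y\<close> with \<open>U\<^sup>* y\<close> of norm one, the functional given by \<open>x\<close> is bounded by the norm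
  of any \<open>w\<close> with \<open>T x = U w\<close>, since \<open>\<langle>x, T\<^sup>* y\<rangle> = \<langle>T x, y\<rangle> = \<langle>w, U\<^sup>* y\<rangle>\<close>. The
  same identity shows that \<open>T\<^sup>* y\<close> vanishes with \<open>U\<^sup>* y\<close>. Uniform boundedness takes the place of the
  closed graph theorem, which is the usual tool here.\<close>
lemma adjoint_majorised_if_range_subset:
  assumes h1: "hilbert_space s\<^sub>1 ip\<^sub>1" and h2: "hilbert_space s\<^sub>2 ip\<^sub>2" and h3: "hilbert_space s\<^sub>3 ip\<^sub>3"
    and T: "T \<in> continuous_linear_maps s\<^sub>1 s\<^sub>3" and U: "U \<in> continuous_linear_maps s\<^sub>2 s\<^sub>3"
    and range: "range T \<subseteq> range U"
  shows "\<exists>K>0. \<forall>y. norm (hilbert_adjoint ip\<^sub>1 ip\<^sub>3 T y) \<le> K * norm (hilbert_adjoint ip\<^sub>2 ip\<^sub>3 U y)"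
proof -
  interpret h1: hilbert_space s\<^sub>1 ip\<^sub>1 by fact
  interpret h2: hilbert_space s\<^sub>2 ip\<^sub>2 by fact
  interpret h3: hilbert_space s\<^sub>3 ip\<^sub>3 by fact
  define T' where "T' = hilbert_adjoint ip\<^sub>1 ip\<^sub>3 T"
  define U' where "U' = hilbert_adjoint ip\<^sub>2 ip\<^sub>3 U"
  have T'_scaleR: "T' (r *\<^sub>R y) = r *\<^sub>R T' y" and U'_scaleR: "U' (r *\<^sub>R y) = r *\<^sub>R U' y" for r y
    unfolding T'_def U'_def h1.scale_of_real[symmetric] h2.scale_of_real[symmetric]
      h3.scale_of_real[symmetric]
    by (rule continuous_linear_maps_linear(3) hilbert_adjoint_continuous_linear h1 h2 h3 T U)+
  have bound: "\<exists>K. \<forall>y. norm (ip\<^sub>1 x (T' y)) \<le> K * norm (U' y)" for x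
  proof -
    obtain w where "T x = U w" using range by blast
    then have "ip\<^sub>1 x (T' y) = ip\<^sub>2 w (U' y)" for y
      unfolding T'_def U'_def
      by (metis ip_hilbert_adjoint[OF h1 h3 T] ip_hilbert_adjoint[OF h2 h3 U])
    then show ?thesis using h2.Cauchy_Schwarz[of w] by auto
  qed
  obtain C where C: "norm (T' y) \<le> C" if "norm (U' y) = 1" for y
  proof -
    have "\<exists>K. \<forall>v\<in>T' ` {y. norm (U' y) = 1}. norm (ip\<^sub>1 x v) \<le> K" for x
    proof -
      obtain K where "norm (ip\<^sub>1 x (T' y)) \<le> K * norm (U' y)" for y
        using bound by blast
      then have "norm (ip\<^sub>1 x (T' y)) \<le> K" if "norm (U' y) = 1" for y
        using that by (metis mult.right_neutral)
      then show ?thesis by blast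
    qed
    from h1.uniform_boundedness[OF this] show ?thesis using that by blast
  qed
  have "norm (T' y) \<le> (\<bar>C\<bar> + 1) * norm (U' y)" for y
  proof (cases "U' y = 0")
    case True
    have "ip\<^sub>1 x (T' y) = 0" for x
    proof -
      obtain K where "norm (ip\<^sub>1 x (T' y)) \<le> K * norm (U' y)" using bound by blast
      then show ?thesis by (simp add: True)
    qed
    then have "T' y = 0" by (intro h1.ip_self_eq_0D)
    with True show ?thesis by simp
  next
    case False
    then have "norm (T' ((1 / norm (U' y)) *\<^sub>R y)) \<le> C"
      by (intro C) (simp add: U'_scaleR)
    then have "norm (T' y) \<le> C * norm (U' y)"
      using False by (simp add: T'_scaleR field_simps)
    also have "\<dots> \<le> (\<bar>C\<bar> + 1) * norm (U' y)"
      by (intro mult_right_mono) auto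
    finally show ?thesis .
  qed
  then show ?thesis unfolding T'_def U'_def by (intro exI[of _ "\<bar>C\<bar> + 1"]) simp
qed

text \<open>A vector killed by the adjoint of \<open>U\<close> is orthogonal to the range of \<open>U\<close>, hence to its closure,
  which contains the range of \<open>T\<close>.\<close>
lemma adjoint_null_space_subset_if_approximable:
  assumes h1: "hilbert_space s\<^sub>1 ip\<^sub>1" and h2: "hilbert_space s\<^sub>2 ip\<^sub>2" and h3: "hilbert_space s\<^sub>3 ip\<^sub>3"
    and T: "T \<in> continuous_linear_maps s\<^sub>1 s\<^sub>3" and U: "U \<in> continuous_linear_maps s\<^sub>2 s\<^sub>3"
    and approx: "\<And>x \<epsilon>. \<epsilon> > 0 \<Longrightarrow> \<exists>w. norm (T x - U w) \<le> \<epsilon>"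
  shows "null_space (hilbert_adjoint ip\<^sub>2 ip\<^sub>3 U) \<subseteq> null_space (hilbert_adjoint ip\<^sub>1 ip\<^sub>3 T)"
proof
  interpret h1: hilbert_space s\<^sub>1 ip\<^sub>1 by fact
  interpret h2: hilbert_space s\<^sub>2 ip\<^sub>2 by fact
  interpret h3: hilbert_space s\<^sub>3 ip\<^sub>3 by fact
  fix y assume "y \<in> null_space (hilbert_adjoint ip\<^sub>2 ip\<^sub>3 U)"
  then have "ip\<^sub>3 (U w) y = 0" for w
    unfolding ip_hilbert_adjoint[OF h2 h3 U] by (simp add: null_space_def)
  then have "ip\<^sub>3 v y = 0" if "v \<in> closure (range U)" for v
    using h3.ip_closure_eq_0[OF _ that] by blast
  moreover have "T x \<in> closure (range U)" for x
    unfolding closure_approachable_le dist_norm by (metis approx norm_minus_commute rangeI)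
  ultimately have "ip\<^sub>1 x (hilbert_adjoint ip\<^sub>1 ip\<^sub>3 T y) = 0" for x
    unfolding ip_hilbert_adjoint[OF h1 h3 T, symmetric] by blast
  then show "y \<in> null_space (hilbert_adjoint ip\<^sub>1 ip\<^sub>3 T)"
    using h1.ip_self_eq_0D by (auto simp: null_space_def)
qed

section \<open>Exact first component and approximate second component\<close>

theorem proposition1p5:
  fixes s\<^sub>1 :: "'k::real_or_complex \<Rightarrow> 'h1::banach \<Rightarrow> 'h1" and ip\<^sub>1 :: "'h1 \<Rightarrow> 'h1 \<Rightarrow> 'k"
    and s\<^sub>2 :: "'k \<Rightarrow> 'h2::banach \<Rightarrow> 'h2" and ip\<^sub>2 :: "'h2 \<Rightarrow> 'h2 \<Rightarrow> 'k"
    and s\<^sub>4 :: "'k \<Rightarrow> 'h4::banach \<Rightarrow> 'h4" and ip\<^sub>4 :: "'h4 \<Rightarrow> 'h4 \<Rightarrow> 'k"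
    and s\<^sub>5 :: "'k \<Rightarrow> 'h5::banach \<Rightarrow> 'h5" and ip\<^sub>5 :: "'h5 \<Rightarrow> 'h5 \<Rightarrow> 'k"
    and A\<^sub>1 :: "'h1 \<Rightarrow> 'h4" and A\<^sub>2 :: "'h1 \<Rightarrow> 'h5"
    and B\<^sub>1 :: "'h2 \<Rightarrow> 'h4" and B\<^sub>2 :: "'h2 \<Rightarrow> 'h5"
    and A :: "'h1 \<Rightarrow> 'h4 \<times> 'h5" and B :: "'h2 \<Rightarrow> 'h4 \<times> 'h5"
    and A\<^sub>1_adj :: "'h4 \<Rightarrow> 'h1" and A\<^sub>2_adj :: "'h5 \<Rightarrow> 'h1"
    and B\<^sub>1_adj :: "'h4 \<Rightarrow> 'h2" and B\<^sub>2_adj :: "'h5 \<Rightarrow> 'h2"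
    and A_adj :: "'h4 \<times> 'h5 \<Rightarrow> 'h1" and B_adj :: "'h4 \<times> 'h5 \<Rightarrow> 'h2"
    and cond_i cond_ii approx :: bool
  assumes "hilbert_space s\<^sub>1 ip\<^sub>1" and "hilbert_space s\<^sub>2 ip\<^sub>2"
    and "hilbert_space s\<^sub>4 ip\<^sub>4" and "hilbert_space s\<^sub>5 ip\<^sub>5"
    and "A\<^sub>1 \<in> continuous_linear_maps s\<^sub>1 s\<^sub>4" and "A\<^sub>2 \<in> continuous_linear_maps s\<^sub>1 s\<^sub>5"
    and "B\<^sub>1 \<in> continuous_linear_maps s\<^sub>2 s\<^sub>4" and "B\<^sub>2 \<in> continuous_linear_maps s\<^sub>2 s\<^sub>5"
  defines "A \<equiv> \<lambda>h. (A\<^sub>1 h, A\<^sub>2 h)" and "B \<equiv> \<lambda>h. (B\<^sub>1 h, B\<^sub>2 h)"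
    and "A\<^sub>1_adj \<equiv> hilbert_adjoint ip\<^sub>1 ip\<^sub>4 A\<^sub>1" and "A\<^sub>2_adj \<equiv> hilbert_adjoint ip\<^sub>1 ip\<^sub>5 A\<^sub>2"
    and "B\<^sub>1_adj \<equiv> hilbert_adjoint ip\<^sub>2 ip\<^sub>4 B\<^sub>1" and "B\<^sub>2_adj \<equiv> hilbert_adjoint ip\<^sub>2 ip\<^sub>5 B\<^sub>2"
    and "A_adj \<equiv> hilbert_adjoint ip\<^sub>1 (prod_ip ip\<^sub>4 ip\<^sub>5) A"
    and "B_adj \<equiv> hilbert_adjoint ip\<^sub>2 (prod_ip ip\<^sub>4 ip\<^sub>5) B"
    and "cond_i \<equiv> (\<exists>C>0. \<forall>h\<^sub>4. norm (A\<^sub>1_adj h\<^sub>4) \<le> C * norm (B\<^sub>1_adj h\<^sub>4)) \<and>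
           null_space B_adj \<subseteq> null_space A_adj"
    and "cond_ii \<equiv> (\<exists>C\<^sub>1 \<in> continuous_linear_maps s\<^sub>1 s\<^sub>2. A\<^sub>1 = B\<^sub>1 \<circ> C\<^sub>1) \<and>
           (\<exists>D \<in> linear_maps s\<^sub>2 s\<^sub>1. A_adj = D \<circ> B_adj)"
    and "approx \<equiv> (\<forall>h\<^sub>1. \<forall>\<epsilon>>0. \<exists>h\<^sub>2. A\<^sub>1 h\<^sub>1 = B\<^sub>1 h\<^sub>2 \<and> norm (A\<^sub>2 h\<^sub>1 - B\<^sub>2 h\<^sub>2) \<le> \<epsilon>)"
  shows "(null_space B_adj \<subseteq> null_space A_adj \<longleftrightarrow>
           (\<forall>h\<^sub>4 h\<^sub>5. B\<^sub>1_adj h\<^sub>4 + B\<^sub>2_adj h\<^sub>5 = 0 \<longrightarrow> A\<^sub>1_adj h\<^sub>4 + A\<^sub>2_adj h\<^sub>5 = 0)) \<and>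
         ((\<exists>C\<^sub>1 \<in> continuous_linear_maps s\<^sub>1 s\<^sub>2. A\<^sub>1 = B\<^sub>1 \<circ> C\<^sub>1) \<longleftrightarrow>
           (\<exists>D\<^sub>1 \<in> continuous_linear_maps s\<^sub>2 s\<^sub>1. A\<^sub>1_adj = D\<^sub>1 \<circ> B\<^sub>1_adj)) \<and>
         (cond_i \<longleftrightarrow> cond_ii) \<and>
         (approx \<longrightarrow> cond_i \<and> cond_ii)"
proof -
  note h1 = assms(1) and h2 = assms(2) and h4 = assms(3) and h5 = assms(4)
    and A1 = assms(5) and A2 = assms(6) and B1 = assms(7) and B2 = assms(8)
  note h3 = hilbert_space_prod[OF h4 h5]
  have A: "A \<in> continuous_linear_maps s\<^sub>1 (\<lambda>c u. (s\<^sub>4 c (fst u), s\<^sub>5 c (snd u)))"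
    unfolding A_def by (rule continuous_linear_maps_Pair[OF A1 A2 h4 h5])
  have B: "B \<in> continuous_linear_maps s\<^sub>2 (\<lambda>c u. (s\<^sub>4 c (fst u), s\<^sub>5 c (snd u)))"
    unfolding B_def by (rule continuous_linear_maps_Pair[OF B1 B2 h4 h5])
  have A_adj: "A_adj = (\<lambda>u. A\<^sub>1_adj (fst u) + A\<^sub>2_adj (snd u))"
    unfolding A_adj_def A_def A\<^sub>1_adj_def A\<^sub>2_adj_def by (rule hilbert_adjoint_Pair[OF h1 h4 h5 A1 A2])
  have B_adj: "B_adj = (\<lambda>u. B\<^sub>1_adj (fst u) + B\<^sub>2_adj (snd u))"
    unfolding B_adj_def B_def B\<^sub>1_adj_def B\<^sub>2_adj_def by (rule hilbert_adjoint_Pair[OF h2 h4 h5 B1 B2])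
  have kernels: "null_space B_adj \<subseteq> null_space A_adj \<longleftrightarrow>
      (\<forall>h\<^sub>4 h\<^sub>5. B\<^sub>1_adj h\<^sub>4 + B\<^sub>2_adj h\<^sub>5 = 0 \<longrightarrow> A\<^sub>1_adj h\<^sub>4 + A\<^sub>2_adj h\<^sub>5 = 0)"
    unfolding A_adj B_adj null_space_def subset_iff by simp
  have factors: "(\<exists>C\<^sub>1 \<in> continuous_linear_maps s\<^sub>1 s\<^sub>2. A\<^sub>1 = B\<^sub>1 \<circ> C\<^sub>1) \<longleftrightarrow>
      (\<exists>D\<^sub>1 \<in> continuous_linear_maps s\<^sub>2 s\<^sub>1. A\<^sub>1_adj = D\<^sub>1 \<circ> B\<^sub>1_adj)"
    unfolding A\<^sub>1_adj_def B\<^sub>1_adj_def by (rule factor_iff_adjoint_factor[OF h1 h2 h4 A1 B1])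
  have algebraic: "null_space B_adj \<subseteq> null_space A_adj \<longleftrightarrow>
      (\<exists>D \<in> linear_maps s\<^sub>2 s\<^sub>1. A_adj = D \<circ> B_adj)"
    unfolding A_adj_def B_adj_def
    by (rule null_space_subset_iff_factor[OF
        continuous_linear_maps_linear(1)[OF hilbert_adjoint_continuous_linear[OF h2 h3 B]]
        continuous_linear_maps_linear(1)[OF hilbert_adjoint_continuous_linear[OF h1 h3 A]]])
  have equivalent: "cond_i \<longleftrightarrow> cond_ii"
    unfolding cond_i_def cond_ii_def algebraic A\<^sub>1_adj_def B\<^sub>1_adj_def
      factor_iff_adjoint_majorised[OF h1 h2 h4 A1 B1] ..
  have "cond_i" if approx
  proof -
    from that have approx: "\<exists>h\<^sub>2. A\<^sub>1 h\<^sub>1 = B\<^sub>1 h\<^sub>2 \<and> norm (A\<^sub>2 h\<^sub>1 - B\<^sub>2 h\<^sub>2) \<le> \<epsilon>" if "\<epsilon> > 0" for h\<^sub>1 \<epsilon>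
      using \<open>\<epsilon> > 0\<close> unfolding approx_def by blast
    then have "range A\<^sub>1 \<subseteq> range B\<^sub>1"
      using zero_less_one by blast
    moreover have "\<exists>h\<^sub>2. norm (A h\<^sub>1 - B h\<^sub>2) \<le> \<epsilon>" if "\<epsilon> > 0" for h\<^sub>1 \<epsilon>
    proof -
      obtain h\<^sub>2 where "A\<^sub>1 h\<^sub>1 = B\<^sub>1 h\<^sub>2" "norm (A\<^sub>2 h\<^sub>1 - B\<^sub>2 h\<^sub>2) \<le> \<epsilon>"
        using approx[OF \<open>\<epsilon> > 0\<close>] by blast
      then have "norm (A h\<^sub>1 - B h\<^sub>2) \<le> \<epsilon>"
        by (simp add: A_def B_def norm_prod_def)
      then show ?thesis ..
    qed
    ultimately show ?thesis
      using adjoint_majorised_if_range_subset[OF h1 h2 h4 A1 B1]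
        adjoint_null_space_subset_if_approximable[OF h1 h2 h3 A B]
      unfolding cond_i_def A\<^sub>1_adj_def B\<^sub>1_adj_def A_adj_def B_adj_def by blast
  qed
  with kernels factors equivalent show ?thesis by blast
qed

end
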